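(* The free group $F_2$ of rank $2$ does not have the IRO-extension property. In fact, there is a (deterministic) invariant partial order $\prec$ on $F_2$, i.e. a partial order fixed by the R-action of $F_2$, such that the IRO $\delta_\prec$ (the point mass at $\prec$) has no extension; that is, $\prec$ cannot be extended to an invariant random total order.
   Context: A partial order on a set $X$ is a binary relation $\prec$ that is transitive, antisymmetric ($x\prec y$ implies not $y\prec x$) and antireflexive (never $x\prec x$). It is total if $x\neq y$ implies $x\prec y$ or $y\prec x$. $\mathrm{pOrd}(X)$ and $\mathrm{tOrd}(X)$ denote the sets of all partial, respectively total, orders on $X$, viewed as subsets of $2^{X\times X}$ with the product topology; for countable $X$ they are compact metrizable. For $\omega\in \mathrm{pOrd}(X)$, $\mathrm{Ext}(\omega)$ is the set of total orders $\prec$ on $X$ such that $x\,\omega\, y$ implies $x\prec y$. $\mathrm{OrdExt}(X)\subset \mathrm{pOrd}(X)\times \mathrm{tOrd}(X)$ is the closed set of pairs $(\omega,\omega')$ with $\omega'\in \mathrm{Ext}(\omega)$. Let $G$ be a countable group. The R-action of $G$ on $\mathrm{pOrd}(G)$ is the left action given by $x\,(g\prec)\,y$ iff $xg\prec yg$. It preserves $\mathrm{tOrd}(G)$, and $G$ acts diagonally on $\mathrm{OrdExt}(G)$. An invariant random (partial) order (IRO) on $G$ is a Borel probability measure $\nu$ on $\mathrm{pOrd}(G)$ invariant under the R-action. An extension of an IRO $\nu$ is a $G$-invariant Borel probability measure $\lambda$ on $\mathrm{OrdExt}(G)$ whose projection to $\mathrm{pOrd}(G)$ is $\nu$. $G$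 has the IRO-extension property if every IRO on $G$ has an extension. *)

theory Defs
  imports "HOL-Probability.Probability" "HOL-Algebra.Group"
begin

section \<open>Free groups\<close>

text \<open>
  A letter \<open>(s, False)\<close> stands for the generator \<open>s\<close> and \<open>(s, True)\<close> for its formal inverse.
  The free group on \<open>S\<close> consists of the reduced words in these letters; the product is
  concatenation followed by free reduction.
\<close>

type_synonym 's word = "('s \<times> bool) list"

definition inv_letter :: "'s \<times> bool \<Rightarrow> 's \<times> bool" where
  "inv_letter x = (fst x, \<not> snd x)"

definition reduced :: "'s word \<Rightarrow> bool" where
  "reduced w \<longleftrightarrow> successively (\<lambda>x y. y \<noteq> inv_letter x) w"

definition cons_reduce :: "'s \<times> bool \<Rightarrow> 's word \<Rightarrow> 's word" where
  "cons_reduce x w = (if w \<noteq> [] \<and> hd w = inv_letter x then tl w else x # w)"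

definition free_group :: "'s set \<Rightarrow> 's word monoid" where
  "free_group S =
     \<lparr>carrier = {w. reduced w \<and> fst ` set w \<subseteq> S}, mult = foldr cons_reduce, one = []\<rparr>"

definition F2 :: "bool word monoid" where
  "F2 = free_group (UNIV :: bool set)"

lemma inv_letter_simps [simp]:
  "inv_letter (inv_letter x) = x" "fst (inv_letter x) = fst x"
  "inv_letter x \<noteq> x" "x \<noteq> inv_letter x" "inv_letter (s, b) = (s, \<not> b)"
  by (auto simp: inv_letter_def prod_eq_iff)

lemma reduced_Nil [simp]: "reduced []"
  by (simp add: reduced_def)

lemma reduced_Cons: "reduced (x # w) \<longleftrightarrow> w = [] \<or> hd w \<noteq> inv_letter x \<and> reduced w"
  by (auto simp: reduced_def successively_Cons)

lemma reduced_cons_reduce: "reduced w \<Longrightarrow> reduced (cons_reduce x w)"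
  by (cases w) (auto simp: cons_reduce_def reduced_Cons)

lemma set_cons_reduce: "set (cons_reduce x w) \<subseteq> insert x (set w)"
  by (cases w) (auto simp: cons_reduce_def)

lemma cons_reduce_inv: "reduced w \<Longrightarrow> cons_reduce x (cons_reduce (inv_letter x) w) = w"
  by (cases w; cases "tl w") (auto simp: cons_reduce_def reduced_Cons)

lemma reduced_foldr: "reduced w \<Longrightarrow> reduced (foldr cons_reduce u w)"
  by (induction u) (auto intro: reduced_cons_reduce)

lemma set_foldr: "set (foldr cons_reduce u w) \<subseteq> set u \<union> set w"
proof (induction u)
  case (Cons x u)
  then show ?case using set_cons_reduce[of x "foldr cons_reduce u w"] by auto
qed simp

lemma foldr_cons_reduce:
  assumes "reduced w"
  shows "foldr cons_reduce (cons_reduce x u) w = cons_reduce x (foldr cons_reduce u w)"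
proof (cases "u \<noteq> [] \<and> hd u = inv_letter x")
  case True
  then obtain u' where "u = inv_letter x # u'" by (cases u) auto
  then show ?thesis
    using cons_reduce_inv[OF reduced_foldr[OF assms]] by (simp add: cons_reduce_def)
next
  case False
  then have "cons_reduce x u = x # u" unfolding cons_reduce_def by (rule if_not_P)
  then show ?thesis by simp
qed

lemma foldr_assoc:
  "reduced w \<Longrightarrow>
     foldr cons_reduce (foldr cons_reduce u v) w = foldr cons_reduce u (foldr cons_reduce v w)"
  by (induction u) (auto simp: foldr_cons_reduce)

lemma foldr_Nil: "reduced u \<Longrightarrow> foldr cons_reduce u [] = u"
  by (induction u) (auto simp: reduced_Cons cons_reduce_def)

lemma reduced_inverse: "reduced u \<Longrightarrow> reduced (rev (map inv_letter u))"
  unfolding reduced_def successively_rev successively_map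
  by (erule successively_mono) (metis inv_letter_simps(1))

lemma foldr_inverse: "foldr cons_reduce (rev (map inv_letter u)) u = []"
  by (induction u) (auto simp: cons_reduce_def)

theorem group_free_group: "group (free_group S)"
proof (rule groupI)
  fix x y assume "x \<in> carrier (free_group S)" "y \<in> carrier (free_group S)"
  then show "x \<otimes>\<^bsub>free_group S\<^esub> y \<in> carrier (free_group S)"
    using image_mono[OF set_foldr[of x y], of fst] reduced_foldr[of y x]
    by (simp add: free_group_def image_Un) blast
next
  fix x assume "x \<in> carrier (free_group S)"
  then show "\<exists>y\<in>carrier (free_group S). y \<otimes>\<^bsub>free_group S\<^esub> x = \<one>\<^bsub>free_group S\<^esub>"
    by (intro bexI[of _ "rev (map inv_letter x)"])
       (auto simp: free_group_def foldr_inverse intro: reduced_inverse)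
qed (auto simp: free_group_def foldr_assoc)

theorem free_group_universal:
  assumes "group H" and f: "f \<in> S \<rightarrow> carrier H"
  shows "\<exists>h. h \<in> hom (free_group S) H \<and> (\<forall>s\<in>S. h [(s, False)] = f s)"
proof -
  interpret H: group H by fact
  define e where "e x = (if snd x then inv\<^bsub>H\<^esub> (f (fst x)) else f (fst x))" for x
  define h where "h w = foldr (\<lambda>x y. e x \<otimes>\<^bsub>H\<^esub> y) w \<one>\<^bsub>H\<^esub>" for w
  have e: "e x \<in> carrier H" if "fst x \<in> S" for x
    using that f by (auto simp: e_def)
  have e_inv: "e (inv_letter x) = inv\<^bsub>H\<^esub> (e x)" if "fst x \<in> S" for x
    using that H.inv_inv[of "f (fst x)"] f by (simp add: e_def inv_letter_def Pi_iff)
  have h: "h w \<in> carrier H" if "fst ` set w \<subseteq> S" for w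
    using that by (induction w) (auto simp: h_def intro!: H.m_closed e)
  have h_Cons: "h (x # w) = e x \<otimes>\<^bsub>H\<^esub> h w" for x w
    by (simp add: h_def)
  have h_cons_reduce: "h (cons_reduce x w) = e x \<otimes>\<^bsub>H\<^esub> h w"
    if "fst x \<in> S" "fst ` set w \<subseteq> S" for x w
  proof (cases "w \<noteq> [] \<and> hd w = inv_letter x")
    case True
    then obtain v where w: "w = inv_letter x # v" by (cases w) auto
    have "h (cons_reduce x w) = h v" by (simp add: w cons_reduce_def)
    also have "\<dots> = e x \<otimes>\<^bsub>H\<^esub> (inv\<^bsub>H\<^esub> (e x) \<otimes>\<^bsub>H\<^esub> h v)"
      using that e h by (simp add: w H.m_assoc[symmetric])
    finally show ?thesis using that by (simp add: w h_Cons e_inv)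
  next
    case False
    then have "cons_reduce x w = x # w" unfolding cons_reduce_def by (rule if_not_P)
    then show ?thesis by (simp add: h_Cons)
  qed
  have "h (foldr cons_reduce u v) = h u \<otimes>\<^bsub>H\<^esub> h v"
    if "fst ` set u \<subseteq> S" "fst ` set v \<subseteq> S" for u v
    using that(1)
  proof (induction u)
    case Nil
    then show ?case using h[OF that(2)] by (simp add: h_def)
  next
    case (Cons x u)
    have "fst ` set (foldr cons_reduce u v) \<subseteq> S"
      using set_foldr[of u v] Cons.prems that(2) by fastforce
    then show ?case
      using Cons h that(2) e by (simp add: h_cons_reduce h_Cons H.m_assoc)
  qed
  then have "h \<in> hom (free_group S) H"
    using h by (auto simp: hom_def free_group_def)
  moreover have "h [(s, False)] = f s" if "s \<in> S" for s
    using that f by (auto simp: h_def e_def Pi_iff)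
  ultimately show ?thesis by blast
qed

theorem free_group_hom_unique:
  assumes "group H" and h: "h \<in> hom (free_group S) H" and k: "k \<in> hom (free_group S) H"
    and eq: "\<And>s. s \<in> S \<Longrightarrow> h [(s, False)] = k [(s, False)]"
    and w: "w \<in> carrier (free_group S)"
  shows "h w = k w"
proof -
  interpret H: group H by fact
  interpret F: group "free_group S" by (rule group_free_group)
  have hk: "group_hom (free_group S) H h" "group_hom (free_group S) H k"
    using h k by (auto intro!: group_hom.intro group_hom_axioms.intro assms group_free_group)
  have letter: "[x] \<in> carrier (free_group S)" if "fst x \<in> S" for x
    using that by (auto simp: free_group_def reduced_def)
  have inv_eq: "[(s, True)] = inv\<^bsub>free_group S\<^esub> [(s, False)]" if "s \<in> S" for s
    using that
    by (intro F.inv_equality[symmetric] letter) (auto simp: free_group_def cons_reduce_def)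
  have eq': "h [x] = k [x]" if "fst x \<in> S" for x
    using that eq hk
    by (cases x; cases "snd x")
       (auto simp: inv_eq letter group_hom.hom_inv)
  show ?thesis using w
  proof (induction w)
    case Nil
    then show ?case
      using group_hom.hom_one[OF hk(1)] group_hom.hom_one[OF hk(2)] by (simp add: free_group_def)
  next
    case (Cons x w)
    then have x: "fst x \<in> S" and v: "w \<in> carrier (free_group S)"
      by (auto simp: free_group_def reduced_Cons)
    have "x # w = [x] \<otimes>\<^bsub>free_group S\<^esub> w"
      using Cons.prems by (auto simp: free_group_def reduced_Cons cons_reduce_def)
    then show ?case
      using h k Cons.IH[OF v] eq'[OF x] letter[OF x] v by (simp add: hom_mult)
  qed
qed

lemma group_F2: "group F2"
  unfolding F2_def by (rule group_free_group)

lemma countable_F2: "countable (carrier F2)"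
  by (rule countableI_type)


section \<open>Partial and total orders\<close>

text \<open>
  Relations on \<open>X\<close> are the predicates on the ambient type that vanish off \<open>X \<times> X\<close>. The function
  topology on \<open>'a \<Rightarrow> 'a \<Rightarrow> bool\<close> is the iterated product of the discrete topology on
  \<open>bool\<close>, that is, the topology of pointwise convergence; on relations on \<open>X\<close> it restricts to the
  product topology of \<open>2\<close> to the power \<open>X \<times> X\<close>.
\<close>

definition pOrd :: "'a set \<Rightarrow> ('a \<Rightarrow> 'a \<Rightarrow> bool) set" where
  "pOrd X = {r. (\<forall>x y. r x y \<longrightarrow> x \<in> X \<and> y \<in> X) \<and> transp_on X r \<and> asymp_on X r \<and> irreflp_on X r}"

definition tOrd :: "'a set \<Rightarrow> ('a \<Rightarrow> 'a \<Rightarrow> bool) set" where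
  "tOrd X = {r \<in> pOrd X. totalp_on X r}"

definition Ext :: "'a set \<Rightarrow> ('a \<Rightarrow> 'a \<Rightarrow> bool) \<Rightarrow> ('a \<Rightarrow> 'a \<Rightarrow> bool) set" where
  "Ext X \<omega> = {r \<in> tOrd X. \<forall>x y. \<omega> x y \<longrightarrow> r x y}"

definition OrdExt :: "'a set \<Rightarrow> (('a \<Rightarrow> 'a \<Rightarrow> bool) \<times> ('a \<Rightarrow> 'a \<Rightarrow> bool)) set" where
  "OrdExt X = {(\<omega>, \<omega>'). \<omega> \<in> pOrd X \<and> \<omega>' \<in> Ext X \<omega>}"

definition pOrd_borel :: "'a set \<Rightarrow> ('a \<Rightarrow> 'a \<Rightarrow> bool) measure" where
  "pOrd_borel X = restrict_space borel (pOrd X)"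

definition OrdExt_borel :: "'a set \<Rightarrow> (('a \<Rightarrow> 'a \<Rightarrow> bool) \<times> ('a \<Rightarrow> 'a \<Rightarrow> bool)) measure" where
  "OrdExt_borel X = restrict_space borel (OrdExt X)"


section \<open>Invariant random orders and their extensions\<close>

definition R_act :: "('a, 'b) monoid_scheme \<Rightarrow> 'a \<Rightarrow> ('a \<Rightarrow> 'a \<Rightarrow> bool) \<Rightarrow> 'a \<Rightarrow> 'a \<Rightarrow> bool" where
  "R_act G g r = (\<lambda>x y. x \<in> carrier G \<and> y \<in> carrier G \<and> r (x \<otimes>\<^bsub>G\<^esub> g) (y \<otimes>\<^bsub>G\<^esub> g))"

definition IRO :: "('a, 'b) monoid_scheme \<Rightarrow> ('a \<Rightarrow> 'a \<Rightarrow> bool) measure \<Rightarrow> bool" where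
  "IRO G \<nu> \<longleftrightarrow>
     prob_space \<nu> \<and>
     sets \<nu> = sets (pOrd_borel (carrier G)) \<and>
     (\<forall>g\<in>carrier G. distr \<nu> \<nu> (R_act G g) = \<nu>)"

definition IRO_extension ::
  "('a, 'b) monoid_scheme \<Rightarrow> ('a \<Rightarrow> 'a \<Rightarrow> bool) measure \<Rightarrow>
    (('a \<Rightarrow> 'a \<Rightarrow> bool) \<times> ('a \<Rightarrow> 'a \<Rightarrow> bool)) measure \<Rightarrow> bool" where
  "IRO_extension G \<nu> \<mu> \<longleftrightarrow>
     prob_space \<mu> \<and>
     sets \<mu> = sets (OrdExt_borel (carrier G)) \<and>
     (\<forall>g\<in>carrier G. distr \<mu> \<mu> (map_prod (R_act G g) (R_act G g)) = \<mu>) \<and>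
     distr \<mu> (pOrd_borel (carrier G)) fst = \<nu>"

definition IRO_extension_property :: "('a, 'b) monoid_scheme \<Rightarrow> bool" where
  "IRO_extension_property G \<longleftrightarrow> (\<forall>\<nu>. IRO G \<nu> \<longrightarrow> (\<exists>\<mu>. IRO_extension G \<nu> \<mu>))"

definition point_mass :: "'a set \<Rightarrow> ('a \<Rightarrow> 'a \<Rightarrow> bool) \<Rightarrow> ('a \<Rightarrow> 'a \<Rightarrow> bool) measure" where
  "point_mass X r = return (pOrd_borel X) r"

text \<open>
  \<^const>\<open>distr\<close> is a genuine push-forward only along measurable maps; the maps used above are
  measurable.
\<close>

lemma space_pOrd_borel: "space (pOrd_borel X) = pOrd X"
  by (simp add: pOrd_borel_def space_restrict_space)

lemma space_OrdExt_borel: "space (OrdExt_borel X) = OrdExt X"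
  by (simp add: OrdExt_borel_def space_restrict_space)

lemma R_act_pOrd:
  assumes "group G" "g \<in> carrier G" "r \<in> pOrd (carrier G)"
  shows "R_act G g r \<in> pOrd (carrier G)"
proof -
  interpret group G by fact
  have [simp]: "x \<otimes>\<^bsub>G\<^esub> g \<in> carrier G" if "x \<in> carrier G" for x using that assms by simp
  have r: "transp_on (carrier G) r" "asymp_on (carrier G) r" "irreflp_on (carrier G) r"
    using assms(3) by (auto simp: pOrd_def)
  have "transp_on (carrier G) (R_act G g r)"
  proof (rule transp_onI)
    fix x y z assume "R_act G g r x y" "R_act G g r y z"
    then show "R_act G g r x z"
      using transp_onD[OF r(1), of "x \<otimes>\<^bsub>G\<^esub> g" "y \<otimes>\<^bsub>G\<^esub> g" "z \<otimes>\<^bsub>G\<^esub> g"] by (simp add: R_act_def)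
  qed
  moreover have "asymp_on (carrier G) (R_act G g r)"
  proof (rule asymp_onI)
    fix x y assume "R_act G g r x y"
    then show "\<not> R_act G g r y x"
      using asymp_onD[OF r(2), of "x \<otimes>\<^bsub>G\<^esub> g" "y \<otimes>\<^bsub>G\<^esub> g"] by (simp add: R_act_def)
  qed
  moreover have "irreflp_on (carrier G) (R_act G g r)"
  proof (rule irreflp_onI)
    fix x assume "x \<in> carrier G"
    then show "\<not> R_act G g r x x"
      using irreflp_onD[OF r(3), of "x \<otimes>\<^bsub>G\<^esub> g"] by (simp add: R_act_def)
  qed
  ultimately show ?thesis by (simp add: pOrd_def) (simp add: R_act_def)
qed

lemma R_act_tOrd:
  assumes "group G" "g \<in> carrier G" "r \<in> tOrd (carrier G)"
  shows "R_act G g r \<in> tOrd (carrier G)"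
proof -
  interpret group G by fact
  have [simp]: "x \<otimes>\<^bsub>G\<^esub> g \<in> carrier G" if "x \<in> carrier G" for x using that assms by simp
  show ?thesis
    using assms R_act_pOrd[OF assms(1,2)] unfolding tOrd_def
    by (auto simp: totalp_on_def R_act_def)
qed

lemma R_act_OrdExt:
  assumes "group G" "g \<in> carrier G" "p \<in> OrdExt (carrier G)"
  shows "map_prod (R_act G g) (R_act G g) p \<in> OrdExt (carrier G)"
  using assms(3) R_act_pOrd[OF assms(1,2)] R_act_tOrd[OF assms(1,2)]
  by (cases p) (simp add: OrdExt_def Ext_def, simp add: R_act_def)

lemma R_act_mult:
  assumes "group G" "g \<in> carrier G" "h \<in> carrier G"
  shows "R_act G (g \<otimes>\<^bsub>G\<^esub> h) r = R_act G g (R_act G h r)"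
proof -
  interpret group G by fact
  show ?thesis using assms by (auto simp: R_act_def fun_eq_iff m_assoc)
qed

lemma continuous_on_R_act: "continuous_on UNIV (R_act G g)"
proof -
  have coord: "continuous_on UNIV (\<lambda>r :: 'a \<Rightarrow> 'a \<Rightarrow> bool. r x y)" for x y
    using continuous_on_compose2[OF continuous_on_product_coordinates[of y] continuous_on_product_coordinates[of x]] by simp
  have "continuous_on UNIV (\<lambda>r. R_act G g r x y)" for x y
    by (cases "x \<in> carrier G \<and> y \<in> carrier G") (auto simp: R_act_def coord)
  then show ?thesis
    by (intro continuous_on_coordinatewise_then_product) auto
qed

lemma measurable_R_act:
  assumes "group G" "g \<in> carrier G"
  shows "R_act G g \<in> measurable (pOrd_borel (carrier G)) (pOrd_borel (carrier G))"
  using R_act_pOrd[OF assms] continuous_on_R_act[of G g] unfolding pOrd_borel_def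
  by (intro measurable_restrict_space3 borel_measurable_continuous_onI) auto

lemma measurable_R_act_OrdExt:
  assumes "group G" "g \<in> carrier G"
  shows "map_prod (R_act G g) (R_act G g)
           \<in> measurable (OrdExt_borel (carrier G)) (OrdExt_borel (carrier G))"
proof -
  have "continuous_on UNIV (\<lambda>p. (R_act G g (fst p), R_act G g (snd p)))"
    by (intro continuous_on_Pair continuous_on_compose2[OF continuous_on_R_act] continuous_intros) auto
  then show ?thesis
    using R_act_OrdExt[OF assms] unfolding OrdExt_borel_def
    by (intro measurable_restrict_space3 borel_measurable_continuous_onI)
       (auto simp: map_prod_def case_prod_unfold)
qed

lemma measurable_fst_OrdExt: "fst \<in> measurable (OrdExt_borel X) (pOrd_borel X)"
  unfolding OrdExt_borel_def pOrd_borel_def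
  by (intro measurable_restrict_space3 borel_measurable_continuous_onI continuous_intros)
     (auto simp: OrdExt_def)

end

theory Submission
  imports Defs
begin

text \<open>
  Let \<open>a\<close>, \<open>b\<close> be the free generators. The reduced words that begin with \<open>b\<close> or its inverse and
  end with \<open>a\<close> or its inverse multiply without any cancellation, so they form a semigroup that
  misses \<open>1\<close>. Hence putting \<open>x \<prec> y\<close> whenever \<open>y x\<^sup>-\<^sup>1\<close> is such a word gives a partial order that is
  invariant under right translation.

  This order contains large crowns. Let \<open>g\<close> be \<open>a\<close> or its inverse. For \<open>m \<noteq> n\<close> the quotient
  \<open>b\<^sup>n (g b\<^sup>m)\<^sup>-\<^sup>1 = b\<^sup>n\<^sup>-\<^sup>m g\<^sup>-\<^sup>1\<close> is a word as above, so \<open>g b\<^sup>m \<prec> b\<^sup>n\<close>. In a total extension \<open><\<close> the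
  relations \<open>b\<^sup>m < g b\<^sup>m\<close> and \<open>b\<^sup>n < g b\<^sup>n\<close> exclude each other, since together they close the cycle
  \<open>b\<^sup>m < g b\<^sup>m < b\<^sup>n < g b\<^sup>n < b\<^sup>m\<close>. If the extension is random and invariant, then \<open>b\<^sup>n < g b\<^sup>n\<close> has the
  same probability as \<open>1 < g\<close> for every \<open>n\<close>. The three exclusive events for \<open>n = 0, 1, 2\<close> show that
  this probability is at most \<open>1/3\<close>. For \<open>g = a\<close> this bounds the probability of \<open>1 < a\<close>, and for
  \<open>g = a\<^sup>-\<^sup>1\<close> it bounds, after translation by \<open>a\<close>, that of \<open>a < 1\<close>. But the two add up to \<open>1\<close>.

  The probabilistic half (\<open>crown_bound\<close>, \<open>no_extension_of_crowned_order\<close>) works in every group;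
  freeness enters only through \<open>ba_words_mult\<close> and \<open>ba_order_crown\<close>.
\<close>

section \<open>Orders from positive cones\<close>

text \<open>
  The quotient is formed as \<open>y x\<^sup>-\<^sup>1\<close>, not \<open>x\<^sup>-\<^sup>1 y\<close>, because the R-action multiplies from the right.
\<close>

definition cone_order :: "('a, 'b) monoid_scheme \<Rightarrow> 'a set \<Rightarrow> 'a \<Rightarrow> 'a \<Rightarrow> bool" where
  "cone_order G P x y \<longleftrightarrow> x \<in> carrier G \<and> y \<in> carrier G \<and> y \<otimes>\<^bsub>G\<^esub> inv\<^bsub>G\<^esub> x \<in> P"

lemma cone_order_pOrd:
  assumes "group G" and mult: "\<And>u v. u \<in> P \<Longrightarrow> v \<in> P \<Longrightarrow> u \<otimes>\<^bsub>G\<^esub> v \<in> P"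
    and one: "\<one>\<^bsub>G\<^esub> \<notin> P"
  shows "cone_order G P \<in> pOrd (carrier G)"
proof -
  interpret group G by fact
  have trans: "cone_order G P x z" if "cone_order G P x y" "cone_order G P y z" for x y z
  proof -
    have "z \<otimes>\<^bsub>G\<^esub> inv\<^bsub>G\<^esub> x = (z \<otimes>\<^bsub>G\<^esub> inv\<^bsub>G\<^esub> y) \<otimes>\<^bsub>G\<^esub> (y \<otimes>\<^bsub>G\<^esub> inv\<^bsub>G\<^esub> x)"
      using that by (simp add: cone_order_def m_assoc) (simp add: m_assoc[symmetric])
    with that mult show ?thesis by (simp add: cone_order_def)
  qed
  have irrefl: "\<not> cone_order G P x x" for x
    using one by (auto simp: cone_order_def)
  have asym: "\<not> cone_order G P y x" if "cone_order G P x y" for x y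
    using trans[OF that] irrefl by blast
  have field: "x \<in> carrier G \<and> y \<in> carrier G" if "cone_order G P x y" for x y
    using that by (simp add: cone_order_def)
  show ?thesis
    unfolding pOrd_def transp_on_def asymp_on_def irreflp_on_def
    using trans irrefl asym field by blast
qed

lemma R_act_cone_order:
  assumes "group G" "g \<in> carrier G"
  shows "R_act G g (cone_order G P) = cone_order G P"
proof -
  interpret group G by fact
  have "(y \<otimes>\<^bsub>G\<^esub> g) \<otimes>\<^bsub>G\<^esub> inv\<^bsub>G\<^esub> (x \<otimes>\<^bsub>G\<^esub> g) = y \<otimes>\<^bsub>G\<^esub> inv\<^bsub>G\<^esub> x"
    if "x \<in> carrier G" "y \<in> carrier G" for x y
    using that assms by (simp add: inv_mult_group m_assoc) (simp add: m_assoc[symmetric])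
  then show ?thesis
    using assms by (auto simp: R_act_def cone_order_def fun_eq_iff)
qed

lemma IRO_point_mass:
  assumes "group G" and r: "r \<in> pOrd (carrier G)"
    and inv: "\<And>g. g \<in> carrier G \<Longrightarrow> R_act G g r = r"
  shows "IRO G (point_mass (carrier G) r)"
proof -
  let ?M = "pOrd_borel (carrier G)"
  have "distr (return ?M r) (return ?M r) (R_act G g) = return ?M r" if g: "g \<in> carrier G" for g
  proof -
    have "distr (return ?M r) (return ?M r) (R_act G g) = distr (return ?M r) ?M (R_act G g)"
      by (rule distr_cong) auto
    also have "\<dots> = return ?M (R_act G g r)"
      using r measurable_R_act[OF assms(1) g] by (intro distr_return) (auto simp: space_pOrd_borel)
    finally show ?thesis by (simp add: inv[OF g])
  qed
  then show ?thesis
    using r by (simp add: IRO_def point_mass_def prob_space_return space_pOrd_borel)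
qed

section \<open>Crowns\<close>

lemma sets_pOrd_borel_less: "{r \<in> pOrd X. r x y} \<in> sets (pOrd_borel X)"
proof -
  have "continuous_on UNIV (\<lambda>r :: 'a \<Rightarrow> 'a \<Rightarrow> bool. r x y)"
    using continuous_on_compose2[OF continuous_on_product_coordinates[of y]
        continuous_on_product_coordinates[of x]] by simp
  moreover have "open {True}"
  proof -
    have "{True} = {False<..}" by auto
    then show ?thesis by simp
  qed
  ultimately have "open ((\<lambda>r :: 'a \<Rightarrow> 'a \<Rightarrow> bool. r x y) -` {True})"
    by (rule open_vimage[rotated])
  then have "(\<lambda>r :: 'a \<Rightarrow> 'a \<Rightarrow> bool. r x y) -` {True} \<in> sets borel" by simp
  then show ?thesis
    unfolding pOrd_borel_def sets_restrict_space by (rule rev_image_eqI) auto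
qed

lemma measurable_snd_OrdExt: "snd \<in> measurable (OrdExt_borel X) (pOrd_borel X)"
  unfolding OrdExt_borel_def pOrd_borel_def
  by (intro measurable_restrict_space3 borel_measurable_continuous_onI continuous_intros)
     (auto simp: OrdExt_def Ext_def tOrd_def)

lemma sets_OrdExt_borel_less: "{p \<in> OrdExt X. snd p x y} \<in> sets (OrdExt_borel X)"
proof -
  have "snd -` {r \<in> pOrd X. r x y} \<inter> space (OrdExt_borel X) \<in> sets (OrdExt_borel X)"
    by (rule measurable_sets[OF measurable_snd_OrdExt sets_pOrd_borel_less])
  also have "snd -` {r \<in> pOrd X. r x y} \<inter> space (OrdExt_borel X) = {p \<in> OrdExt X. snd p x y}"
    by (auto simp: space_OrdExt_borel OrdExt_def Ext_def tOrd_def)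
  finally show ?thesis .
qed

text \<open>
  An extension of a point mass at \<open>r\<close> amounts to an invariant random total order that almost surely
  extends \<open>r\<close>: the second component of a random pair \<open>p\<close>.
\<close>

locale point_mass_extension =
  fixes G :: "('a, 'b) monoid_scheme" (structure) and r \<mu>
  assumes group: "group G"
    and r: "r \<in> pOrd (carrier G)"
    and ext: "IRO_extension G (point_mass (carrier G) r) \<mu>"
begin

sublocale group G by (rule group)

sublocale prob_space \<mu>
  using ext by (simp add: IRO_extension_def)

lemma sets_\<mu>: "sets \<mu> = sets (OrdExt_borel (carrier G))"
  using ext by (simp add: IRO_extension_def)

lemma space_\<mu>: "space \<mu> = OrdExt (carrier G)"
  using sets_eq_imp_space_eq[OF sets_\<mu>] by (simp add: space_OrdExt_borel)

definition less_prob :: "'a \<Rightarrow> 'a \<Rightarrow> real" where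
  "less_prob x y = prob {p \<in> space \<mu>. snd p x y}"

lemma sets_less: "{p \<in> space \<mu>. snd p x y} \<in> sets \<mu>"
  using sets_OrdExt_borel_less by (simp add: sets_\<mu> space_\<mu>)

lemma AE_extends:
  assumes "r x y"
  shows "AE p in \<mu>. snd p x y"
proof -
  have "AE \<omega> in return (pOrd_borel (carrier G)) r. \<omega> x y"
    using r assms sets_pOrd_borel_less[of "carrier G" x y]
    by (subst AE_return) (auto simp: space_pOrd_borel pred_def)
  also have "return (pOrd_borel (carrier G)) r = distr \<mu> (pOrd_borel (carrier G)) fst"
    using ext by (simp add: IRO_extension_def point_mass_def)
  finally have "AE p in \<mu>. fst p x y"
    using measurable_fst_OrdExt[of "carrier G"] sets_pOrd_borel_less[of "carrier G" x y]
    by (subst (asm) AE_distr_iff)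
       (auto simp: space_pOrd_borel measurable_cong_sets[OF sets_\<mu> refl])
  then show ?thesis
    by (rule AE_mp, intro AE_I2) (auto simp: space_\<mu> OrdExt_def Ext_def)
qed

lemma less_prob_translate:
  assumes "x \<in> carrier G" "y \<in> carrier G" "h \<in> carrier G"
  shows "less_prob (x \<otimes> h) (y \<otimes> h) = less_prob x y"
proof -
  let ?T = "map_prod (R_act G h) (R_act G h)"
  have T: "?T \<in> measurable \<mu> \<mu>"
    using measurable_R_act_OrdExt[OF group assms(3)]
    by (simp add: measurable_cong_sets[OF sets_\<mu> sets_\<mu>])
  have "distr \<mu> \<mu> ?T = \<mu>"
    using ext assms(3) by (simp add: IRO_extension_def)
  then have "less_prob x y = measure (distr \<mu> \<mu> ?T) {p \<in> space \<mu>. snd p x y}"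
    by (simp add: less_prob_def)
  also have "\<dots> = prob (?T -` {p \<in> space \<mu>. snd p x y} \<inter> space \<mu>)"
    by (rule measure_distr[OF T sets_less])
  also have "?T -` {p \<in> space \<mu>. snd p x y} \<inter> space \<mu> = {p \<in> space \<mu>. snd p (x \<otimes> h) (y \<otimes> h)}"
    using measurable_space[OF T] assms by (auto simp: R_act_def)
  finally show ?thesis by (simp add: less_prob_def)
qed

lemma less_prob_total:
  assumes "x \<in> carrier G" "y \<in> carrier G" "x \<noteq> y"
  shows "less_prob x y + less_prob y x = 1"
proof -
  have tot: "snd p x y \<longleftrightarrow> \<not> snd p y x" if "p \<in> space \<mu>" for p
  proof -
    have "totalp_on (carrier G) (snd p)" "asymp_on (carrier G) (snd p)"
      using that by (auto simp: space_\<mu> OrdExt_def Ext_def tOrd_def pOrd_def)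
    then show ?thesis using assms unfolding totalp_on_def asymp_on_def by blast
  qed
  have "less_prob x y = prob (space \<mu> - {p \<in> space \<mu>. snd p y x})"
    unfolding less_prob_def by (rule arg_cong[of _ _ prob]) (use tot in auto)
  also have "\<dots> = 1 - less_prob y x"
    unfolding less_prob_def by (rule prob_compl[OF sets_less])
  finally show ?thesis by simp
qed

text \<open>
  In a total extension at most one \<open>x \<in> B\<close> can lie below \<open>g \<otimes> x\<close>: two of them, \<open>x\<close> and \<open>y\<close>, would give
  the cycle \<open>x < g \<otimes> x < y < g \<otimes> y < x\<close>. By invariance each of these mutually exclusive events is as
  likely as \<open>\<one> < g\<close>.
\<close>

lemma crown_bound:
  assumes g: "g \<in> carrier G" and B: "finite B" "B \<subseteq> carrier G"
    and crown: "\<And>x y. x \<in> B \<Longrightarrow> y \<in> B \<Longrightarrow> x \<noteq> y \<Longrightarrow> r (g \<otimes> x) y"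
  shows "card B * less_prob \<one> g \<le> 1"
proof -
  let ?E = "\<lambda>x. {p \<in> space \<mu>. snd p x (g \<otimes> x)}"
  have "AE p in \<mu>. \<forall>x\<in>B. \<forall>y\<in>B - {x}. snd p (g \<otimes> x) y"
    using B crown by (intro AE_finite_allI AE_extends) auto
  then have AE: "AE p in \<mu>. (\<Sum>x\<in>B. indicator (?E x) p) \<le> (1 :: real)"
  proof (rule AE_mp, intro AE_I2 impI)
    fix p assume p: "p \<in> space \<mu>"
      and "\<forall>x\<in>B. \<forall>y\<in>B - {x}. snd p (g \<otimes> x) y"
    then have less: "snd p (g \<otimes> x) y" if "x \<in> B" "y \<in> B" "x \<noteq> y" for x y
      using that by blast
    have ord: "snd p \<in> pOrd (carrier G)"
      using p by (auto simp: space_\<mu> OrdExt_def Ext_def tOrd_def)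
    have trans: "snd p u w" if "snd p u v" "snd p v w" for u v w
      using ord that unfolding pOrd_def transp_on_def by blast
    have irrefl: "\<not> snd p u u" for u
      using ord unfolding pOrd_def irreflp_on_def by blast
    have "x = y" if "x \<in> B" "y \<in> B" "p \<in> ?E x" "p \<in> ?E y" for x y
    proof (rule ccontr)
      assume "x \<noteq> y"
      then have "snd p (g \<otimes> x) y" "snd p (g \<otimes> y) x" using that less by auto
      with that have "snd p x x" using trans by blast
      with irrefl show False by blast
    qed
    then have "card {x \<in> B. p \<in> ?E x} \<le> 1"
      using B by (auto simp: card_le_Suc0_iff_eq)
    also have "card {x \<in> B. p \<in> ?E x} = (\<Sum>x\<in>B. indicator (?E x) p)"
      using B by (simp add: indicator_def sum.If_cases Int_def)
    finally have "real (\<Sum>x\<in>B. indicator (?E x) p) \<le> real 1" unfolding of_nat_le_iff .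
    then show "(\<Sum>x\<in>B. indicator (?E x) p) \<le> (1 :: real)" by (simp add: indicator_def)
  qed
  have "prob (?E x) = less_prob \<one> g" if "x \<in> B" for x
  proof -
    have "x \<in> carrier G" using that B by blast
    then show ?thesis
      using less_prob_translate[of \<one> g x] g by (simp add: less_prob_def)
  qed
  then have "card B * less_prob \<one> g = (\<Sum>x\<in>B. prob (?E x))" by simp
  also have "\<dots> = (\<integral>p. (\<Sum>x\<in>B. indicator (?E x) p) \<partial>\<mu>)"
  proof (subst Bochner_Integration.integral_sum)
    have "prob (?E x) = (\<integral>p. indicator (?E x) p \<partial>\<mu>)" for x
      by (simp add: Int_absorb2 subset_eq)
    then show "(\<Sum>x\<in>B. prob (?E x)) = (\<Sum>x\<in>B. \<integral>p. indicator (?E x) p \<partial>\<mu>)" by simp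
  qed (use sets_less in \<open>simp add: less_top[symmetric]\<close>)
  also have "\<dots> \<le> (\<integral>p. 1 \<partial>\<mu>)"
    using AE sets_less
    by (intro integral_mono_AE Bochner_Integration.integrable_sum) (simp_all add: less_top[symmetric])
  finally show ?thesis by (simp add: prob_space)
qed

end

text \<open>
  With more than two elements in each crown, \<open>\<one> < g\<close> and its reverse both have probability below
  one half. The reverse is governed by the crown of \<open>inv g\<close>, because \<open>g < \<one>\<close> translates
  to \<open>\<one> < inv g\<close>.
\<close>

theorem no_extension_of_crowned_order:
  assumes "group G" and r: "r \<in> pOrd (carrier G)"
    and g: "g \<in> carrier G" "g \<noteq> \<one>\<^bsub>G\<^esub>" and B: "B \<subseteq> carrier G" "card B > 2"
    and crown: "\<And>x y. x \<in> B \<Longrightarrow> y \<in> B \<Longrightarrow> x \<noteq> y \<Longrightarrow> r (g \<otimes>\<^bsub>G\<^esub> x) y"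
    and crown': "\<And>x y. x \<in> B \<Longrightarrow> y \<in> B \<Longrightarrow> x \<noteq> y \<Longrightarrow> r (inv\<^bsub>G\<^esub> g \<otimes>\<^bsub>G\<^esub> x) y"
  shows "\<not> IRO_extension G (point_mass (carrier G) r) \<mu>"
proof
  assume "IRO_extension G (point_mass (carrier G) r) \<mu>"
  with assms(1) r interpret point_mass_extension G r \<mu>
    by (intro point_mass_extension.intro)
  have fin: "finite B" using B(2) card.infinite by fastforce
  have "less_prob g \<one>\<^bsub>G\<^esub> = less_prob \<one>\<^bsub>G\<^esub> (inv\<^bsub>G\<^esub> g)"
    using less_prob_translate[of "\<one>\<^bsub>G\<^esub>" "inv\<^bsub>G\<^esub> g" g] g by simp
  then have "card B * less_prob \<one>\<^bsub>G\<^esub> g + card B * less_prob g \<one>\<^bsub>G\<^esub> \<le> 2"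
    using crown_bound[of g B] crown_bound[of "inv\<^bsub>G\<^esub> g" B] fin g B crown crown' by simp
  then have "real (card B) * (less_prob \<one>\<^bsub>G\<^esub> g + less_prob g \<one>\<^bsub>G\<^esub>) \<le> 2"
    by (simp add: distrib_left)
  then show False
    using less_prob_total[of "\<one>\<^bsub>G\<^esub>" g] g B(2) by simp
qed

section \<open>The order on the free group\<close>

lemma foldr_cons_reduce_append: "reduced (u @ v) \<Longrightarrow> foldr cons_reduce u v = u @ v"
  by (induction u) (auto simp: reduced_Cons cons_reduce_def)

lemma carrier_F2: "carrier F2 = {w. reduced w}"
  and mult_F2: "u \<otimes>\<^bsub>F2\<^esub> v = foldr cons_reduce u v"
  and one_F2: "\<one>\<^bsub>F2\<^esub> = []"
  by (simp_all add: F2_def free_group_def)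

lemma inv_F2: "w \<in> carrier F2 \<Longrightarrow> inv\<^bsub>F2\<^esub> w = rev (map inv_letter w)"
  by (rule group.inv_equality[OF group_F2])
     (auto simp: carrier_F2 mult_F2 one_F2 foldr_inverse intro: reduced_inverse)

text \<open>
  The letters of the generator \<open>False\<close>, called \<open>a\<close> here, and of \<open>True\<close>, called \<open>b\<close>, may occur with
  either sign: only the generators at the two ends matter for the absence of cancellation.
\<close>

definition ba_words :: "bool word set" where
  "ba_words = {w. reduced w \<and> w \<noteq> [] \<and> fst (hd w) \<and> \<not> fst (last w)}"

lemma ba_words_mult:
  assumes "u \<in> ba_words" "v \<in> ba_words"
  shows "u \<otimes>\<^bsub>F2\<^esub> v \<in> ba_words"
proof -
  have "reduced (u @ v)"
    using assms by (auto simp: ba_words_def reduced_def successively_append_iff inv_letter_def)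
  then show ?thesis
    using assms by (simp add: ba_words_def mult_F2 foldr_cons_reduce_append)
qed

lemma one_notin_ba_words: "\<one>\<^bsub>F2\<^esub> \<notin> ba_words"
  by (simp add: ba_words_def one_F2)

text \<open>
  The word that witnesses the relation is a nonzero power of \<open>b\<close> followed by the inverse of the
  letter \<open>(False, s)\<close>. The bound \<open>3\<close> only makes the cases finite, so that they can be computed.
\<close>

lemma ba_order_crown:
  assumes "n < 3" "m < 3" "m \<noteq> n"
  shows "cone_order F2 ba_words ([(False, s)] \<otimes>\<^bsub>F2\<^esub> replicate m (True, False)) (replicate n (True, False))"
proof -
  have "n \<in> {0, 1, 2}" "m \<in> {0, 1, 2}" using assms by auto
  then show ?thesis
    using assms(3)
    by (auto simp: numeral_2_eq_2 cone_order_def carrier_F2 mult_F2 inv_F2 ba_words_def reduced_Cons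
        cons_reduce_def)
qed

theorem theorem2:
  shows "\<not> IRO_extension_property F2 \<and>
    (\<exists>r \<in> pOrd (carrier F2).
       (\<forall>g\<in>carrier F2. R_act F2 g r = r) \<and>
       IRO F2 (point_mass (carrier F2) r) \<and>
       \<not> (\<exists>\<mu>. IRO_extension F2 (point_mass (carrier F2) r) \<mu>))"
proof -
  let ?r = "cone_order F2 ba_words" and ?a = "[(False, False)]"
  let ?B = "(\<lambda>n. replicate n (True, False)) ` {..<3}"
  have r: "?r \<in> pOrd (carrier F2)"
    using group_F2 ba_words_mult one_notin_ba_words by (rule cone_order_pOrd)
  have inv: "R_act F2 g ?r = ?r" if "g \<in> carrier F2" for g
    using group_F2 that by (rule R_act_cone_order)
  have iro: "IRO F2 (point_mass (carrier F2) ?r)"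
    using group_F2 r inv by (rule IRO_point_mass)
  have a: "?a \<in> carrier F2" "?a \<noteq> \<one>\<^bsub>F2\<^esub>"
    by (simp_all add: carrier_F2 one_F2 reduced_Cons)
  have B: "?B \<subseteq> carrier F2"
    by (auto simp: carrier_F2 reduced_def successively_conv_nth)
  have "inj_on (\<lambda>n. replicate n (True, False)) {..<3}"
    by (rule inj_onI) (metis length_replicate)
  from card_image[OF this] have card: "card ?B > 2" by simp
  have no_ext: "\<not> IRO_extension F2 (point_mass (carrier F2) ?r) \<mu>" for \<mu>
    by (rule no_extension_of_crowned_order[OF group_F2 r a B card])
       (auto simp: inv_F2[OF a(1)] intro!: ba_order_crown)
  then show ?thesis
    using r inv iro unfolding IRO_extension_property_def by blast
qed

end
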